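(* Let $m$ be a positive integer. Then $$\frac{n!}{(mn)^n} \;\leq\; \mathfrak{d}_m(\mathfrak{gl}_n) \;\leq\; \omega(m)\exp\left(-\frac{n}{4m}\right).$$
   Context: $\omega(m)$ is the number of distinct prime factors of $m$. All Lie algebras are complex, and $\mathfrak{gl}_n$ is the Lie algebra of $n\times n$ matrices, $n$ a positive integer. For $\mathfrak{gl}_n$, let $\Lambda=\mathbb{Z}^n$ be the weight lattice and $\Lambda^+=\{(\lambda_1,\ldots,\lambda_n)\in\mathbb{Z}^n : \lambda_1\geq\cdots\geq\lambda_n\geq 0\}$ the set of dominant weights under consideration. For $\lambda\in\Lambda^+$ let $\pi_\lambda$ be the irreducible representation of $\mathfrak{gl}_n$ of highest weight $\lambda$. Its degree (dimension) is $\deg \pi_\lambda=\mathscr{D}_n(\lambda)=\prod_{1\leq i<j\leq n}\frac{\lambda_i-\lambda_j+j-i}{j-i}$. Put $\Lambda_m^+=\{\lambda\in\Lambda^+ : m\nmid \deg\pi_\lambda\}$ and $$\mathfrak{d}_m(\mathfrak{gl}_n)=\lim_{r\to\infty}\frac{\#\{\lambda\in\Lambda_m^+ : N(\lambda)<r\}}{\#\{\lambda\in\Lambda^+ : N(\lambda)<r\}},$$ where $N$ is any norm on $\mathbb{R}^n$; the limit exists and is independent of $N$. Equivalently, $\mathfrak{d}_m(\mathfrak{gl}_n)$ is the density, defined in the same way, of $\{\lambda\in\Lambda : m\nmid\mathscr{D}_n(\lambda)\}$ in $\Lambda$.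
   Formalization: The lower bound is stated only for m ≠ 1 (for m = 1 the density is 0 but n!/n^n > 0), and the upper bound excludes n = 1 with ω(m) = 1 (there every degree is 1, so the density is 1 > exp(-1/(4m))). *)

theory Defs
  imports
    Complex_Main
    "HOL-Computational_Algebra.Primes"
    "Jordan_Normal_Form.Matrix"
begin

definition omega :: "nat \<Rightarrow> nat" where
  "omega m = card (prime_factors m)"

text \<open>Vectors are indexed from 0, so the entry \<open>\<lambda> $ i\<close> is the coordinate usually called
  \<open>\<lambda>\<^sub>i\<^sub>+\<^sub>1\<close>; index differences such as \<open>j - i\<close> are not affected by the shift.\<close>

definition dominant_weights :: "nat \<Rightarrow> int vec set" where
  "dominant_weights n =
     {l \<in> carrier_vec n. (\<forall>i j. i \<le> j \<and> j < n \<longrightarrow> l $ i \<ge> l $ j) \<and> (\<forall>i<n. l $ i \<ge> 0)}"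

text \<open>The degree of the irreducible representation \<open>\<pi>\<^sub>\<lambda>\<close> of the complex Lie algebra
  \<open>gl\<^sub>n\<close> with highest weight \<open>\<lambda>\<close>, given by Weyl's dimension formula. Although every value
  at a weight is an integer, the product is formed in the rationals because the individual
  factors need not be integers.\<close>

definition gl_degree :: "nat \<Rightarrow> int vec \<Rightarrow> rat" where
  "gl_degree n l =
     (\<Prod>j<n. \<Prod>i<j. (of_int (l $ i - l $ j) + of_nat j - of_nat i) / (of_nat j - of_nat i))"

text \<open>Divisibility is divisibility in the integers; the relation \<open>dvd\<close> on the rationals
  would be trivial.\<close>

definition dominant_weights_not_dvd :: "nat \<Rightarrow> nat \<Rightarrow> int vec set" where
  "dominant_weights_not_dvd m n =
     {l \<in> dominant_weights n. \<not> (\<exists>k::int. gl_degree n l = of_int (int m * k))}"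

definition is_norm :: "nat \<Rightarrow> (real vec \<Rightarrow> real) \<Rightarrow> bool" where
  "is_norm n N \<longleftrightarrow>
     (\<forall>x \<in> carrier_vec n. N x \<ge> 0) \<and>
     (\<forall>x \<in> carrier_vec n. N x = 0 \<longleftrightarrow> x = 0\<^sub>v n) \<and>
     (\<forall>x \<in> carrier_vec n. \<forall>c. N (c \<cdot>\<^sub>v x) = \<bar>c\<bar> * N x) \<and>
     (\<forall>x \<in> carrier_vec n. \<forall>y \<in> carrier_vec n. N (x + y) \<le> N x + N y)"

definition not_dvd_ratio :: "(real vec \<Rightarrow> real) \<Rightarrow> nat \<Rightarrow> nat \<Rightarrow> real \<Rightarrow> real" where
  "not_dvd_ratio N m n r =
     real (card {l \<in> dominant_weights_not_dvd m n. N (map_vec real_of_int l) < r}) /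
     real (card {l \<in> dominant_weights n. N (map_vec real_of_int l) < r})"

text \<open>The density is the common limit for all norms. As this is a definite description, it is
  meaningful only once this limit is known to exist for every norm and not to depend on it.\<close>

definition gl_density :: "nat \<Rightarrow> nat \<Rightarrow> real" where
  "gl_density m n =
     (THE d. \<forall>N. is_norm n N \<longrightarrow> (not_dvd_ratio N m n \<longlongrightarrow> d) at_top)"

end

theory Submission
  imports Defs "HOL-Library.FuncSet" "HOL-Number_Theory.Cong"
begin

text \<open>With the shifted coordinates \<open>x i = l $ i - i\<close>, Weyl's formula says that the degree is the
Vandermonde product of \<open>x\<close> divided by the Vandermonde product of the points \<open>0, -1, \<dots>, -(n - 1)\<close>
that belong to the zero weight. The valuation of such a nonzero product at a prime \<open>p\<close> is the sum over \<open>u \<ge> 1\<close>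
of the number of pairs congruent modulo \<open>p ^ u\<close>, and for every modulus this number is
smallest for consecutive integers (\<open>cong_pairs_initial_le\<close>). So each \<open>p ^ u\<close> contributes a
nonnegative excess to the valuation of the degree.

Choose \<open>t\<close> with \<open>p ^ t \<le> n \<le> p ^ (t + 1)\<close>. Beyond exponent \<open>t\<close> consecutive integers have no congruent pairs,
so a single pair with \<open>x i\<close> and \<open>x j\<close> congruent modulo \<open>p ^ (t + k)\<close> forces \<open>p ^ k\<close> to divide
the degree (\<open>superfact_collision_dvd\<close>). Hence, if \<open>m\<close> does not divide the degree, then for some prime
power \<open>p ^ k\<close> exactly dividing \<open>m\<close> the \<open>x i\<close> are distinct modulo \<open>Q = p ^ (t + k) \<le> m * n\<close>. The
probability of this for random residues is \<open>\<Prod>i<n. 1 - i / Q\<close>, at most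
\<open>exp (- n * (n - 1) / (2 * Q))\<close>, and summing over the primes gives the upper bound. For the lower
bound, if the \<open>x i\<close> form modulo \<open>p ^ (t + 1)\<close> a permutation of consecutive integers, then
every excess vanishes and \<open>p\<close> does not divide the degree
(\<open>not_dvd_vandermonde_if_initial_residues\<close>); \<open>n!\<close> residue vectors have this property.

The density exists because divisibility of the degree by \<open>m\<close> depends only on residues modulo a fixed
\<open>M\<close>, and the dominant weights of norm below \<open>r\<close> are asymptotically equidistributed among the
\<open>M ^ n\<close> classes (\<open>weight_ratio_class\<close>). Translation by a dominant vector maps any class into any
other and moves norms by a bounded amount, so it suffices that the counting function \<open>A\<close>
satisfies \<open>A (r + C) / A r \<longlonglongrightarrow> 1\<close>. This follows from the same comparison of classes:
the multiples of \<open>k\<close> are one of the classes modulo \<open>k\<close>, which relates \<open>A r\<close> to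
\<open>k ^ n * A (r / k)\<close> with a bounded error in the reduced radius (\<open>count_dominant_growth\<close>).\<close>

section \<open>Vandermonde products and congruent pairs\<close>

definition vandermonde :: "nat \<Rightarrow> (nat \<Rightarrow> int) \<Rightarrow> int" where
  "vandermonde n x = (\<Prod>j<n. \<Prod>i<j. x i - x j)"

text \<open>The \<open>p\<close>-adic valuation of a nonzero Vandermonde product is the sum, over the powers \<open>q\<close> of
\<open>p\<close>, of the numbers of pairs of points that are congruent modulo \<open>q\<close>.\<close>

definition cong_pairs :: "int \<Rightarrow> nat \<Rightarrow> (nat \<Rightarrow> int) \<Rightarrow> nat" where
  "cong_pairs q n x = (\<Sum>j<n. \<Sum>i<j. of_bool (q dvd x i - x j))"

lemma sum_square_symmetric:
  fixes g :: "nat \<Rightarrow> nat \<Rightarrow> nat"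
  assumes "\<And>i j. g i j = g j i"
  shows "(\<Sum>i<n. \<Sum>j<n. g i j) = 2 * (\<Sum>j<n. \<Sum>i<j. g i j) + (\<Sum>i<n. g i i)"
proof (induction n)
  case (Suc n)
  have "(\<Sum>j<n. g n j) = (\<Sum>i<n. g i n)"
    by (rule sum.cong) (auto intro: assms)
  with Suc show ?case by (simp add: sum.distrib algebra_simps)
qed simp

text \<open>Summing over ordered pairs, diagonal included, makes the count independent of the order of the
points, so that it can be regrouped by residue classes.\<close>

lemma sum_cong_pairs:
  "(\<Sum>i<n. \<Sum>j<n. of_bool (q dvd x i - x j)) = 2 * cong_pairs q n x + n"
  unfolding cong_pairs_def
  by (subst sum_square_symmetric) (auto simp: dvd_diff_commute)

lemma sum_cong_eq_sum_squares:
  fixes q :: int and x :: "nat \<Rightarrow> int"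
  assumes "q > 0"
  shows "(\<Sum>i<n. \<Sum>j<n. of_bool (q dvd x i - x j)) =
         (\<Sum>c\<in>{0..<q}. (card {i\<in>{..<n}. x i mod q = c})\<^sup>2)"
proof -
  have "(\<Sum>i<n. \<Sum>j<n. of_bool (q dvd x i - x j)) =
        (\<Sum>i<n. card {j\<in>{..<n}. x j mod q = x i mod q})"
    by (intro sum.cong refl, subst sum_of_bool_eq)
       (auto simp: mod_eq_dvd_iff dvd_diff_commute intro!: arg_cong[of _ _ card])
  also have "\<dots> = (\<Sum>c\<in>{0..<q}. \<Sum>i\<in>{i\<in>{..<n}. x i mod q = c}.
                     card {j\<in>{..<n}. x j mod q = x i mod q})"
    using assms by (intro sum.group[symmetric]) auto
  also have "\<dots> = (\<Sum>c\<in>{0..<q}. (card {i\<in>{..<n}. x i mod q = c})\<^sup>2)"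
    by (intro sum.cong) (auto simp: power2_eq_square)
  finally show ?thesis .
qed

lemma card_residue_class_initial:
  fixes c n q :: nat
  assumes "c < q"
  shows "card {i\<in>{..<n}. int i mod int q = int c} \<in> {n div q, Suc (n div q)}"
proof -
  have eq: "{i\<in>{..<n}. int i mod int q = int c} = (\<lambda>u. c + q * u) ` {u. c + q * u < n}"
  proof (intro equalityI subsetI, goal_cases)
    case (1 i)
    hence "int i mod int q = int c" by simp
    hence "i mod q = c" by (metis of_nat_eq_iff zmod_int)
    hence "i = c + q * (i div q)" by (metis add.commute mult_div_mod_eq)
    with 1 show ?case by auto
  next
    case (2 i)
    then show ?case using assms by (auto simp flip: of_nat_mult of_nat_add zmod_int)
  qed
  have inj: "inj_on (\<lambda>u. c + q * u) A" for A
    using assms by (auto simp: inj_on_def)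
  have 1: "{..<n div q} \<subseteq> {u. c + q * u < n}"
  proof safe
    fix u assume "u < n div q"
    hence "q * (u + 1) \<le> q * (n div q)" by (intro mult_le_mono2) simp
    also have "\<dots> \<le> n" by simp
    finally show "c + q * u < n" using assms by simp
  qed
  have 2: "{u. c + q * u < n} \<subseteq> {..<Suc (n div q)}"
  proof safe
    fix u assume "c + q * u < n"
    hence "q * u \<le> n" by simp
    hence "u \<le> n div q" using assms by (simp add: less_eq_div_iff_mult_less_eq mult.commute)
    thus "u < Suc (n div q)" by simp
  qed
  have fin: "finite {u. c + q * u < n}" using 2 finite_subset by blast
  have "n div q \<le> card {u. c + q * u < n}" using card_mono[OF fin 1] by simp
  moreover have "card {u. c + q * u < n} \<le> Suc (n div q)" using card_mono[OF _ 2] by simp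
  ultimately show ?thesis unfolding eq card_image[OF inj] by auto
qed

text \<open>Consecutive integers have the fewest congruent pairs, because they are spread as evenly as
possible over the residue classes. With \<open>N c\<close> points in class \<open>c\<close>, the number of ordered pairs
is \<open>\<Sum>c. (N c)\<^sup>2\<close>. For \<open>a = n div q\<close> the parabola \<open>u\<^sup>2\<close> lies, at integers, on or above its secant
through \<open>a\<close> and \<open>a + 1\<close>, and the sum of the secant values depends only on the total \<open>n\<close>.
Consecutive integers have all class sizes in \<open>{a, a + 1}\<close>, where parabola and secant agree.\<close>

lemma cong_pairs_initial_le:
  fixes q :: nat
  assumes "q > 0"
  shows "cong_pairs (int q) n (\<lambda>i. - int i) \<le> cong_pairs (int q) n x"
proof -
  define N where "N = (\<lambda>x c. card {i\<in>{..<n}. x i mod int q = c})"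
  define a where "a = int (n div q)"
  have tot: "(\<Sum>c\<in>{0..<int q}. N x c) = n" for x :: "nat \<Rightarrow> int"
  proof -
    have "(\<Sum>c\<in>{0..<int q}. N x c) = (\<Sum>c\<in>{0..<int q}. \<Sum>i\<in>{i\<in>{..<n}. x i mod int q = c}. 1)"
      by (simp add: N_def)
    also have "\<dots> = (\<Sum>i<n. 1)"
      using assms by (intro sum.group) auto
    finally show ?thesis by simp
  qed
  define L where "L = (\<lambda>x. \<Sum>c\<in>{0..<int q}. (2 * a + 1) * int (N x c) - a * (a + 1))"
  have L: "L x = (2 * a + 1) * int n - int q * (a * (a + 1))" for x
    unfolding L_def by (simp add: sum_subtractf tot flip: sum_distrib_left of_nat_sum)
  have secant: "(2 * a + 1) * u - a * (a + 1) \<le> u\<^sup>2" for u :: int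
  proof -
    have "0 \<le> (u - a) * (u - (a + 1))"
      by (cases "u \<le> a") (auto intro: mult_nonpos_nonpos mult_nonneg_nonneg)
    thus ?thesis by (simp add: algebra_simps power2_eq_square)
  qed
  have "int (2 * cong_pairs (int q) n int + n) = (\<Sum>c\<in>{0..<int q}. (int (N int c))\<^sup>2)"
    unfolding sum_cong_pairs[symmetric] using assms by (subst sum_cong_eq_sum_squares) (simp_all add: N_def)
  also have "\<dots> = L int"
    unfolding L_def
  proof (intro sum.cong refl)
    fix c assume "c \<in> {0..<int q}"
    hence "N int c \<in> {n div q, Suc (n div q)}"
      using card_residue_class_initial[of "nat c" q n] by (simp add: N_def nat_less_iff)
    thus "(int (N int c))\<^sup>2 = (2 * a + 1) * int (N int c) - a * (a + 1)"
      by (auto simp: a_def power2_eq_square algebra_simps)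
  qed
  also have "\<dots> = L x" by (simp add: L)
  also have "\<dots> \<le> (\<Sum>c\<in>{0..<int q}. (int (N x c))\<^sup>2)"
    unfolding L_def by (intro sum_mono secant)
  also have "\<dots> = int (2 * cong_pairs (int q) n x + n)"
    unfolding sum_cong_pairs[symmetric] using assms by (subst sum_cong_eq_sum_squares) (simp_all add: N_def)
  finally have "cong_pairs (int q) n int \<le> cong_pairs (int q) n x" by linarith
  moreover have "cong_pairs (int q) n (\<lambda>i. - int i) = cong_pairs (int q) n int"
    unfolding cong_pairs_def by (simp add: dvd_diff_commute)
  ultimately show ?thesis by simp
qed

text \<open>The divisibility also holds for \<open>a = 0\<close>, where all \<open>T\<close> powers are counted. So the
resulting bound for Vandermonde products also covers points that coincide.\<close>

lemma power_count_dvd: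
  fixes a p :: int
  shows "p ^ (\<Sum>t\<in>{1..T}. of_bool (p ^ t dvd a)) dvd a"
proof (induction T)
  case (Suc T)
  show ?case
  proof (cases "p ^ Suc T dvd a")
    case True
    hence "p ^ t dvd a" if "t \<le> Suc T" for t
      using that power_le_dvd by blast
    hence "(\<Sum>t\<in>{1..Suc T}. of_bool (p ^ t dvd a)) = (\<Sum>t\<in>{1..Suc T}. 1::nat)"
      by (intro sum.cong) auto
    thus ?thesis using True by simp
  qed (use Suc in simp)
qed simp

lemma multiplicity_eq_count:
  fixes a p :: int
  assumes "prime p" "\<not> p ^ T dvd a"
  shows "multiplicity p a = (\<Sum>t\<in>{1..T}. of_bool (p ^ t dvd a))"
proof -
  have a: "a \<noteq> 0" using assms(2) by auto
  have p: "\<not> is_unit p" using assms(1) not_prime_unit by blast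
  have "multiplicity p a < T" using multiplicity_lessI[OF a p assms(2)] .
  hence "{1..T} \<inter> {t. t \<le> multiplicity p a} = {1..multiplicity p a}" by auto
  thus ?thesis
    by (simp add: power_dvd_iff_le_multiplicity[OF a p] sum.If_cases of_bool_def)
qed

lemma sum_cong_pairs_swap:
  "(\<Sum>t\<in>A. cong_pairs (f t) n x) = (\<Sum>j<n. \<Sum>i<j. \<Sum>t\<in>A. of_bool (f t dvd x i - x j))"
  unfolding cong_pairs_def
  by (subst sum.swap, intro sum.cong refl, subst sum.swap, rule refl)

lemma power_cong_pairs_dvd_vandermonde:
  "p ^ (\<Sum>t\<in>{1..T}. cong_pairs (p ^ t) n x) dvd vandermonde n x"
  unfolding vandermonde_def sum_cong_pairs_swap
  by (subst power_sum, intro prod_dvd_prod, subst power_sum, intro prod_dvd_prod power_count_dvd)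

text \<open>If no two points are congruent modulo \<open>p ^ T\<close>, then no higher power of \<open>p\<close> contributes, and the
lower bound for the valuation is attained.\<close>

lemma multiplicity_vandermonde:
  assumes "prime p" "\<And>i j. i < j \<Longrightarrow> j < n \<Longrightarrow> \<not> p ^ T dvd x i - x j"
  shows "vandermonde n x \<noteq> 0"
    and "multiplicity p (vandermonde n x) = (\<Sum>t\<in>{1..T}. cong_pairs (p ^ t) n x)"
proof -
  have nz: "x i - x j \<noteq> 0" if "i < j" "j < n" for i j
    using assms(2)[OF that] by (intro notI) simp
  thus "vandermonde n x \<noteq> 0" by (auto simp: vandermonde_def)
  have "multiplicity p (vandermonde n x) = (\<Sum>j<n. multiplicity p (\<Prod>i<j. x i - x j))"
    unfolding vandermonde_def using nz assms(1)
    by (intro prime_elem_multiplicity_prod_distrib) auto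
  also have "\<dots> = (\<Sum>j<n. \<Sum>i<j. multiplicity p (x i - x j))"
    using nz assms(1) by (intro sum.cong prime_elem_multiplicity_prod_distrib) auto
  also have "\<dots> = (\<Sum>j<n. \<Sum>i<j. \<Sum>t\<in>{1..T}. of_bool (p ^ t dvd x i - x j))"
    using assms by (intro sum.cong refl multiplicity_eq_count) auto
  finally show "multiplicity p (vandermonde n x) = (\<Sum>t\<in>{1..T}. cong_pairs (p ^ t) n x)"
    by (simp only: sum_cong_pairs_swap)
qed

text \<open>The points \<open>0, -1, -2, \<dots>\<close> are the shifted coordinates of the zero weight; their Vandermonde
product \<open>\<Prod>j<n. \<Prod>i<j. j - i\<close> is the denominator in Weyl's formula, a superfactorial.\<close>

abbreviation superfact :: "nat \<Rightarrow> int" where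
  "superfact n \<equiv> vandermonde n (\<lambda>i. - int i)"

lemma not_dvd_initial:
  assumes "i < j" "j < n" "n \<le> p ^ T"
  shows "\<not> int p ^ T dvd - int i - - int j"
proof
  assume "int p ^ T dvd - int i - - int j"
  hence "int p ^ T \<le> int (j - i)" using assms by (intro zdvd_imp_le) auto
  moreover have "int (j - i) < int (p ^ T)" using assms by (simp only: of_nat_less_iff)
  ultimately show False by simp
qed

lemma multiplicity_superfact:
  assumes "prime p" "n \<le> p ^ T"
  shows "multiplicity (int p) (superfact n) = (\<Sum>t\<in>{1..T}. cong_pairs (int p ^ t) n (\<lambda>i. - int i))"
  using assms by (intro multiplicity_vandermonde not_dvd_initial) auto

lemma superfact_pos: "superfact n > 0"
  unfolding vandermonde_def by (intro prod_pos) auto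

text \<open>Weyl's quotient is a \<open>p\<close>-adic integer: the points of the denominator minimise the number of
congruent pairs modulo every power of \<open>p\<close> simultaneously.\<close>

lemma superfact_prime_power_dvd:
  assumes "prime p"
  shows "int p ^ multiplicity (int p) (superfact n) dvd vandermonde n x"
proof -
  have "n < p ^ n" using prime_gt_1_nat[OF assms] by (intro less_exp[THEN less_le_trans] power_mono) auto
  hence "multiplicity (int p) (superfact n) = (\<Sum>t\<in>{1..n}. cong_pairs (int p ^ t) n (\<lambda>i. - int i))"
    using assms by (intro multiplicity_superfact) auto
  also have "\<dots> \<le> (\<Sum>t\<in>{1..n}. cong_pairs (int p ^ t) n x)"
    using cong_pairs_initial_le[of "p ^ _"] prime_gt_0_nat[OF assms] by (intro sum_mono) simp
  finally show ?thesis
    using power_cong_pairs_dvd_vandermonde[of "int p" n x n] by (rule power_le_dvd[rotated])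
qed

text \<open>Modulo the powers \<open>p ^ u\<close> with \<open>u > t\<close> the consecutive integers are pairwise incongruent. A pair
of points that is congruent modulo \<open>p ^ (t + k)\<close> contributes to each of the \<open>k\<close> exponents
\<open>t < u \<le> t + k\<close>, so it forces \<open>k\<close> factors \<open>p\<close> more than the denominator has.\<close>

lemma superfact_collision_dvd:
  assumes p: "prime p" and n: "n \<le> p ^ Suc t" and ij: "i < j" "j < n"
    and coll: "int p ^ (t + k) dvd x i - x j"
  shows "int p ^ (multiplicity (int p) (superfact n) + k) dvd vandermonde n x"
proof (cases "k = 0")
  case True
  thus ?thesis using superfact_prime_power_dvd[OF p] by simp
next
  case False
  have pp: "p > 0" using prime_gt_0_nat[OF p] .
  have nle: "n \<le> p ^ u" if "u > t" for u
  proof -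
    have "p ^ Suc t \<le> p ^ u" using that pp by (intro power_increasing) auto
    with n show ?thesis by simp
  qed
  have split: "{1..t + k} = {1..t} \<union> {t<..t + k}" by auto
  have "multiplicity (int p) (superfact n) = (\<Sum>u\<in>{1..t + k}. cong_pairs (int p ^ u) n (\<lambda>i. - int i))"
    using p False nle[of "t + k"] by (intro multiplicity_superfact) auto
  also have "\<dots> = (\<Sum>u\<in>{1..t}. cong_pairs (int p ^ u) n (\<lambda>i. - int i)) +
                   (\<Sum>u\<in>{t<..t + k}. cong_pairs (int p ^ u) n (\<lambda>i. - int i))"
    unfolding split by (rule sum.union_disjoint) auto
  also have "(\<Sum>u\<in>{t<..t + k}. cong_pairs (int p ^ u) n (\<lambda>i. - int i)) = 0"
  proof (intro sum.neutral ballI)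
    fix u assume "u \<in> {t<..t + k}"
    hence "n \<le> p ^ u" using nle by auto
    thus "cong_pairs (int p ^ u) n (\<lambda>i. - int i) = 0"
      unfolding cong_pairs_def using not_dvd_initial[of _ _ n p u] by (intro sum.neutral ballI) auto
  qed
  finally have v: "multiplicity (int p) (superfact n) =
      (\<Sum>u\<in>{1..t}. cong_pairs (int p ^ u) n (\<lambda>i. - int i))" by simp
  have "k = (\<Sum>u\<in>{t<..t + k}. 1)" by simp
  also have "\<dots> \<le> (\<Sum>u\<in>{t<..t + k}. cong_pairs (int p ^ u) n x)"
  proof (intro sum_mono)
    fix u assume "u \<in> {t<..t + k}"
    hence "int p ^ u dvd x i - x j" using coll power_le_dvd by auto
    hence "1 = of_bool (int p ^ u dvd x i - x j)" by simp
    also have "\<dots> \<le> (\<Sum>i<j. of_bool (int p ^ u dvd x i - x j) :: nat)"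
      using ij by (intro member_le_sum) auto
    also have "\<dots> \<le> cong_pairs (int p ^ u) n x"
      unfolding cong_pairs_def using ij by (intro member_le_sum[of j]) auto
    finally show "1 \<le> cong_pairs (int p ^ u) n x" .
  qed
  finally have "k \<le> (\<Sum>u\<in>{t<..t + k}. cong_pairs (int p ^ u) n x)" .
  moreover have "multiplicity (int p) (superfact n) \<le> (\<Sum>u\<in>{1..t}. cong_pairs (int p ^ u) n x)"
    unfolding v using cong_pairs_initial_le[of "p ^ _"] pp by (intro sum_mono) simp
  moreover have "(\<Sum>u\<in>{1..t + k}. cong_pairs (int p ^ u) n x) =
     (\<Sum>u\<in>{1..t}. cong_pairs (int p ^ u) n x) + (\<Sum>u\<in>{t<..t + k}. cong_pairs (int p ^ u) n x)"
    unfolding split by (rule sum.union_disjoint) auto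
  ultimately have "multiplicity (int p) (superfact n) + k \<le> (\<Sum>u\<in>{1..t + k}. cong_pairs (int p ^ u) n x)"
    by simp
  thus ?thesis
    using power_cong_pairs_dvd_vandermonde[of "int p" n x "t + k"] by (rule power_le_dvd[rotated])
qed

text \<open>If \<open>m\<close> does not divide Weyl's quotient, then some prime power \<open>p ^ k\<close> exactly dividing \<open>m\<close> does
not, and by the previous lemma the points cannot collide modulo \<open>p ^ (t + k)\<close>.\<close>

lemma not_dvd_vandermonde_imp_distinct:
  assumes "m > 0" and "\<not> int m * superfact n dvd vandermonde n x"
  obtains p where "p \<in> prime_factors m"
    and "\<And>t. n \<le> p ^ Suc t \<Longrightarrow> inj_on (\<lambda>i. x i mod int p ^ (t + multiplicity p m)) {..<n}"
proof -
  have nz: "vandermonde n x \<noteq> 0" using assms(2) by auto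
  have sf: "superfact n \<noteq> 0" using superfact_pos[of n] by simp
  have "\<exists>q. prime q \<and> \<not> multiplicity q (int m * superfact n) \<le> multiplicity q (vandermonde n x)"
    using multiplicity_le_imp_dvd[of "int m * superfact n" "vandermonde n x"] assms sf nz by auto
  then obtain q :: int where q: "prime q"
    and less: "\<not> multiplicity q (int m * superfact n) \<le> multiplicity q (vandermonde n x)" by blast
  define p where "p = nat q"
  have qp: "q = int p" using prime_gt_0_int[OF q] by (simp add: p_def)
  have p: "prime p" using q by (simp add: qp)
  have nu: "\<not> is_unit (int p)" using q qp not_prime_unit by blast
  have "multiplicity (int p) (int m * superfact n) = multiplicity (int p) (int m) + multiplicity (int p) (superfact n)"
    using q qp sf assms(1) by (intro prime_elem_multiplicity_mult_distrib) auto
  also have "multiplicity (int p) (int m) = multiplicity p m"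
    unfolding multiplicity_def by (simp flip: of_nat_power)
  finally have nd: "\<not> int p ^ (multiplicity (int p) (superfact n) + multiplicity p m) dvd vandermonde n x"
    using less by (simp add: power_dvd_iff_le_multiplicity[OF nz nu] qp add.commute)
  have "multiplicity p m \<noteq> 0"
    using nd superfact_prime_power_dvd[OF p, of n x] by (intro notI) simp
  hence mem: "p \<in> prime_factors m" using p assms(1)
    by (simp add: prime_factors_multiplicity)
  show thesis
  proof (rule that[OF mem])
    fix t assume n: "n \<le> p ^ Suc t"
    show "inj_on (\<lambda>i. x i mod int p ^ (t + multiplicity p m)) {..<n}"
    proof (rule linorder_inj_onI')
      fix i j assume "i \<in> {..<n}" "j \<in> {..<n}" "i < j"
      thus "x i mod int p ^ (t + multiplicity p m) \<noteq> x j mod int p ^ (t + multiplicity p m)"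
        using superfact_collision_dvd[OF p n, of i j "multiplicity p m" x] nd
        by (auto simp: mod_eq_dvd_iff)
    qed
  qed
qed

text \<open>The count of ordered pairs can be written as a sum over the set of residues modulo \<open>Q\<close> alone, so
the order in which the points take these residues is irrelevant.\<close>

lemma cong_pairs_eq_if_same_residues:
  fixes Q q :: int
  assumes "q dvd Q" "inj_on (\<lambda>i. x i mod Q) {..<n}" "inj_on (\<lambda>i. y i mod Q) {..<n}"
    and "(\<lambda>i. x i mod Q) ` {..<n} = (\<lambda>i. y i mod Q) ` {..<n}"
  shows "cong_pairs q n x = cong_pairs q n y"
proof -
  have *: "2 * cong_pairs q n z + n = (\<Sum>a\<in>(\<lambda>i. z i mod Q) ` {..<n}. \<Sum>b\<in>(\<lambda>i. z i mod Q) ` {..<n}. of_bool (q dvd a - b))"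
    if "inj_on (\<lambda>i. z i mod Q) {..<n}" for z
  proof -
    have "q dvd z i mod Q - z j mod Q \<longleftrightarrow> q dvd z i - z j" for i j
      using assms(1) by (simp add: mod_mod_cancel flip: mod_eq_dvd_iff)
    thus ?thesis
      by (simp add: sum.reindex[OF that] flip: sum_cong_pairs)
  qed
  show ?thesis using *[OF assms(2)] *[OF assms(3)] assms(4) by simp
qed

text \<open>If the points are, modulo \<open>p ^ T \<ge> n\<close>, a permutation of consecutive integers, then numerator and
denominator have the same number of congruent pairs modulo each \<open>p ^ u\<close> with \<open>u \<le> T\<close>, and none
modulo higher powers. Hence Weyl's quotient is prime to \<open>p\<close>.\<close>

lemma not_dvd_vandermonde_if_initial_residues:
  assumes p: "prime p" and n: "n \<le> p ^ T"
    and inj: "inj_on (\<lambda>i. x i mod int p ^ T) {..<n}"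
    and img: "(\<lambda>i. x i mod int p ^ T) ` {..<n} = (\<lambda>i. (- int i) mod int p ^ T) ` {..<n}"
  shows "\<not> int p * superfact n dvd vandermonde n x"
proof
  assume dvd: "int p * superfact n dvd vandermonde n x"
  have P: "prime (int p)" using p by simp
  have nd: "\<not> int p ^ T dvd x i - x j" if "i < j" "j < n" for i j
    using inj_onD[OF inj, of i j] that by (auto simp: mod_eq_dvd_iff)
  have inj0: "inj_on (\<lambda>i. (- int i) mod int p ^ T) {..<n}"
    using not_dvd_initial[OF _ _ n] by (intro linorder_inj_onI') (auto simp: mod_eq_dvd_iff)
  have "multiplicity (int p) (vandermonde n x) = (\<Sum>t\<in>{1..T}. cong_pairs (int p ^ t) n x)"
    using P nd by (intro multiplicity_vandermonde)
  also have "\<dots> = multiplicity (int p) (superfact n)"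
    unfolding multiplicity_superfact[OF p n]
    using inj inj0 img
    by (intro sum.cong refl cong_pairs_eq_if_same_residues[of _ "int p ^ T"]) (auto intro: le_imp_power_dvd)
  finally have "multiplicity (int p) (vandermonde n x) = multiplicity (int p) (superfact n)" .
  moreover have "multiplicity (int p) (int p * superfact n) = Suc (multiplicity (int p) (superfact n))"
    using superfact_pos[of n] P by (intro multiplicity_times_same) auto
  moreover have "multiplicity (int p) (int p * superfact n) \<le> multiplicity (int p) (vandermonde n x)"
    using dvd multiplicity_vandermonde(1)[OF P nd] by (intro dvd_imp_multiplicity_le) auto
  ultimately show False by simp
qed

section \<open>Norms on real coordinate space\<close>

lemma is_norm_triangle:
  "is_norm n N \<Longrightarrow> x \<in> carrier_vec n \<Longrightarrow> y \<in> carrier_vec n \<Longrightarrow> N (x + y) \<le> N x + N y"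
  by (simp add: is_norm_def)

text \<open>The bound follows by applying the triangle inequality to the coordinate expansion; the induction
truncates \<open>x\<close> to its first \<open>k\<close> coordinates.\<close>

lemma norm_le_weighted_l1:
  assumes N: "is_norm n N" and x: "x \<in> carrier_vec n"
  shows "N x \<le> (\<Sum>i<n. \<bar>x $ i\<bar> * N (unit_vec n i))"
proof -
  have "N (vec n (\<lambda>i. if i < k then x $ i else 0)) \<le> (\<Sum>i<k. \<bar>x $ i\<bar> * N (unit_vec n i))"
    if "k \<le> n" for k
    using that
  proof (induction k)
    case 0
    have "vec n (\<lambda>i. 0 :: real) = 0\<^sub>v n" by auto
    moreover have "N (0\<^sub>v n) = 0" using N by (simp add: is_norm_def)
    ultimately show ?case by simp
  next
    case (Suc k)
    have "vec n (\<lambda>i. if i < Suc k then x $ i else 0) =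
          vec n (\<lambda>i. if i < k then x $ i else 0) + x $ k \<cdot>\<^sub>v unit_vec n k"
      by (intro eq_vecI) (auto simp: unit_vec_def less_Suc_eq)
    also have "N \<dots> \<le> N (vec n (\<lambda>i. if i < k then x $ i else 0)) + N (x $ k \<cdot>\<^sub>v unit_vec n k)"
      by (rule is_norm_triangle[OF N]) simp_all
    also have "N (x $ k \<cdot>\<^sub>v unit_vec n k) = \<bar>x $ k\<bar> * N (unit_vec n k)"
      using N by (simp add: is_norm_def)
    finally show ?case using Suc by simp
  qed
  from this[of n] have "N (vec n (\<lambda>i. if i < n then x $ i else 0)) \<le> (\<Sum>i<n. \<bar>x $ i\<bar> * N (unit_vec n i))"
    by simp
  moreover have "vec n (\<lambda>i. if i < n then x $ i else 0) = x"
    using x by (intro eq_vecI) auto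
  ultimately show ?thesis by (simp only:)
qed

lemma bounded_coordinates_convergent_subseq:
  fixes X :: "nat \<Rightarrow> nat \<Rightarrow> real"
  assumes "\<And>k i. i < n \<Longrightarrow> \<bar>X k i\<bar> \<le> B"
  shows "\<exists>r L. strict_mono r \<and> (\<forall>i<n. (\<lambda>k. X (r k) i) \<longlonglongrightarrow> L i)"
  using assms
proof (induction n)
  case 0
  show ?case by (intro exI[of _ id]) (auto simp: strict_mono_def)
next
  case (Suc n)
  then obtain r L where r: "strict_mono r" and L: "\<And>i. i < n \<Longrightarrow> (\<lambda>k. X (r k) i) \<longlonglongrightarrow> L i"
    by auto
  obtain s where s: "strict_mono s" and mono: "monoseq (\<lambda>k. X (r (s k)) n)"
    using seq_monosub[of "\<lambda>k. X (r k) n"] by auto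
  have "Bseq (\<lambda>k. X (r (s k)) n)"
    using Suc.prems by (intro BseqI'[of _ B]) auto
  with mono obtain l where l: "(\<lambda>k. X (r (s k)) n) \<longlonglongrightarrow> l"
    using Bseq_monoseq_convergent convergent_def by blast
  have "(\<lambda>k. X (r (s k)) i) \<longlonglongrightarrow> (L(n := l)) i" if "i < Suc n" for i
    using that l LIMSEQ_subseq_LIMSEQ[OF L s] by (cases "i = n") (auto simp: o_def)
  moreover have "strict_mono (\<lambda>k. r (s k))" using r s by (simp add: strict_mono_def)
  ultimately show ?case by (intro exI[of _ "\<lambda>k. r (s k)"] exI[of _ "L(n := l)"]) auto
qed

text \<open>The half of the equivalence of norms that needs compactness. Vectors on the \<open>l1\<close> unit sphere with
norms tending to \<open>0\<close> would have a coordinatewise convergent subsequence; its limit lies on the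
sphere and has norm \<open>0\<close>.\<close>

lemma l1_le_norm:
  assumes N: "is_norm n N"
  obtains c where "c > 0" "\<And>x. x \<in> carrier_vec n \<Longrightarrow> c * (\<Sum>i<n. \<bar>x $ i\<bar>) \<le> N x"
proof -
  have "\<exists>c>0. \<forall>x\<in>carrier_vec n. c * (\<Sum>i<n. \<bar>x $ i\<bar>) \<le> N x"
  proof (rule ccontr)
    assume none: "\<not> ?thesis"
    have "\<exists>y\<in>carrier_vec n. (\<Sum>i<n. \<bar>y $ i\<bar>) = 1 \<and> N y < 1 / real (Suc k)" for k
    proof -
      have "1 / real (Suc k) > 0" by simp
      then obtain x where x: "x \<in> carrier_vec n" and lt: "N x < 1 / real (Suc k) * (\<Sum>i<n. \<bar>x $ i\<bar>)"
        using none by (meson not_le)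
      define S where "S = (\<Sum>i<n. \<bar>x $ i\<bar>)"
      have "0 \<le> N x" using N x by (simp add: is_norm_def)
      hence "0 < 1 / real (Suc k) * S" using lt by (simp add: S_def)
      hence S: "S > 0" by (simp add: zero_less_divide_iff)
      have "(\<Sum>i<n. \<bar>((1 / S) \<cdot>\<^sub>v x) $ i\<bar>) = (\<Sum>i<n. \<bar>x $ i\<bar> / S)"
        using x S by (intro sum.cong) (auto simp: abs_mult)
      also have "\<dots> = 1" using S by (simp add: S_def flip: sum_divide_distrib)
      finally have "(\<Sum>i<n. \<bar>((1 / S) \<cdot>\<^sub>v x) $ i\<bar>) = 1" .
      moreover have "N ((1 / S) \<cdot>\<^sub>v x) = N x / S"
        using N x S by (simp add: is_norm_def)
      moreover have "N x / S < 1 / real (Suc k)"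
        using lt S by (simp add: S_def field_simps)
      ultimately show ?thesis using x by (intro bexI[of _ "(1 / S) \<cdot>\<^sub>v x"]) auto
    qed
    then obtain Y where Y: "\<And>k. Y k \<in> carrier_vec n" "\<And>k. (\<Sum>i<n. \<bar>Y k $ i\<bar>) = 1"
      "\<And>k. N (Y k) < 1 / real (Suc k)"
      by metis
    have "\<bar>Y k $ i\<bar> \<le> 1" if "i < n" for k i
      using member_le_sum[of i "{..<n}" "\<lambda>i. \<bar>Y k $ i\<bar>"] Y(2)[of k] that by simp
    from bounded_coordinates_convergent_subseq[of n "\<lambda>k i. Y k $ i" 1, OF this]
    obtain r L where r: "strict_mono r" and L: "\<And>i. i < n \<Longrightarrow> (\<lambda>k. Y (r k) $ i) \<longlonglongrightarrow> L i" by blast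
    define v where "v = vec n L"
    have "(\<lambda>k. \<Sum>i<n. \<bar>Y (r k) $ i\<bar>) \<longlonglongrightarrow> (\<Sum>i<n. \<bar>L i\<bar>)"
      using L by (intro tendsto_sum tendsto_rabs) auto
    hence "(\<Sum>i<n. \<bar>L i\<bar>) = 1" using Y(2) LIMSEQ_unique tendsto_const by (metis (no_types, lifting) ext)
    hence "\<exists>i<n. L i \<noteq> 0"
      by (metis (mono_tags, lifting) abs_zero lessThan_iff sum.neutral zero_neq_one)
    hence "v \<noteq> 0\<^sub>v n" by (auto simp: v_def vec_eq_iff)
    moreover have v: "v \<in> carrier_vec n" by (simp add: v_def)
    ultimately have pos: "N v > 0" using N by (metis is_norm_def order_le_less)
    have bound: "N v \<le> 1 / real (Suc (r k)) + (\<Sum>i<n. \<bar>L i - Y (r k) $ i\<bar> * N (unit_vec n i))" for k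
    proof -
      have "v = Y (r k) + (v - Y (r k))" using v Y(1)[of "r k"] by auto
      hence "N v \<le> N (Y (r k)) + N (v - Y (r k))"
        using is_norm_triangle[OF N, of "Y (r k)" "v - Y (r k)"] v Y(1)[of "r k"] by simp
      also have "N (v - Y (r k)) \<le> (\<Sum>i<n. \<bar>(v - Y (r k)) $ i\<bar> * N (unit_vec n i))"
        using v Y(1)[of "r k"] by (intro norm_le_weighted_l1[OF N]) simp
      also have "\<dots> = (\<Sum>i<n. \<bar>L i - Y (r k) $ i\<bar> * N (unit_vec n i))"
        using v Y(1)[of "r k"] by (intro sum.cong) (auto simp: v_def)
      finally show ?thesis using Y(3)[of "r k"] by simp
    qed
    have "(\<lambda>k. 1 / real (Suc (r k)) + (\<Sum>i<n. \<bar>L i - Y (r k) $ i\<bar> * N (unit_vec n i)))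
          \<longlonglongrightarrow> 0 + (\<Sum>i<n. \<bar>L i - L i\<bar> * N (unit_vec n i))"
      using L LIMSEQ_subseq_LIMSEQ[OF LIMSEQ_Suc[OF lim_1_over_n] r]
      by (intro tendsto_add tendsto_sum tendsto_mult tendsto_rabs tendsto_diff tendsto_const)
         (auto simp: o_def)
    hence "N v \<le> 0 + (\<Sum>i<n. \<bar>L i - L i\<bar> * N (unit_vec n i))"
      by (rule LIMSEQ_le_const) (use bound in auto)
    with pos show False by simp
  qed
  thus thesis using that by blast
qed

section \<open>Equidistribution of dominant weights among residue classes\<close>

definition count_below :: "(real vec \<Rightarrow> real) \<Rightarrow> int vec set \<Rightarrow> real \<Rightarrow> nat" where
  "count_below N S r = card {l \<in> S. N (map_vec real_of_int l) < r}"

lemma dominant_weights_carrier: "l \<in> dominant_weights n \<Longrightarrow> l \<in> carrier_vec n"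
  by (simp add: dominant_weights_def)

text \<open>Finiteness guards the later counts: the cardinality of an infinite set would be \<open>0\<close>.\<close>

lemma finite_weights_below:
  assumes N: "is_norm n N" and "S \<subseteq> dominant_weights n"
  shows "finite {l \<in> S. N (map_vec real_of_int l) < r}"
proof -
  obtain c where c: "c > 0" "\<And>x. x \<in> carrier_vec n \<Longrightarrow> c * (\<Sum>i<n. \<bar>x $ i\<bar>) \<le> N x"
    using l1_le_norm[OF N] by blast
  define K where "K = \<lceil>r / c\<rceil>"
  have "{l \<in> S. N (map_vec real_of_int l) < r} \<subseteq> vec n ` ({..<n} \<rightarrow>\<^sub>E {-K..K})"
  proof
    fix l assume "l \<in> {l \<in> S. N (map_vec real_of_int l) < r}"
    hence l: "l \<in> carrier_vec n" and lt: "N (map_vec real_of_int l) < r"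
      using assms(2) dominant_weights_carrier by auto
    have "l $ i \<in> {-K..K}" if i: "i < n" for i
    proof -
      have "\<bar>map_vec real_of_int l $ i\<bar> \<le> (\<Sum>i<n. \<bar>map_vec real_of_int l $ i\<bar>)"
        using i by (intro member_le_sum) auto
      also have "c * \<dots> < r" using c(2)[of "map_vec real_of_int l"] l lt by simp
      hence "(\<Sum>i<n. \<bar>map_vec real_of_int l $ i\<bar>) < r / c" using c(1) by (simp add: field_simps)
      finally have "\<bar>real_of_int (l $ i)\<bar> < r / c" using l i by simp
      also have "\<dots> \<le> of_int K" unfolding K_def by (rule le_of_int_ceiling)
      finally show ?thesis by (auto simp: abs_less_iff)
    qed
    thus "l \<in> vec n ` ({..<n} \<rightarrow>\<^sub>E {-K..K})"
      using l by (intro image_eqI[of _ _ "restrict (\<lambda>i. l $ i) {..<n}"]) auto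
  qed
  thus ?thesis by (rule finite_subset) (intro finite_imageI finite_PiE, auto)
qed

lemma count_below_mono:
  assumes "is_norm n N" "S \<subseteq> T" "T \<subseteq> dominant_weights n" "r \<le> s"
  shows "count_below N S r \<le> count_below N T s"
  unfolding count_below_def
  using assms by (intro card_mono finite_weights_below[of n]) auto

lemma count_below_dominant_pos:
  assumes "is_norm n N" "r > 0"
  shows "count_below N (dominant_weights n) r > 0"
proof -
  have zero: "map_vec real_of_int (0\<^sub>v n) = 0\<^sub>v n" by auto
  have "N (map_vec real_of_int (0\<^sub>v n)) = 0"
    unfolding zero using assms by (simp add: is_norm_def)
  hence "0\<^sub>v n \<in> {l \<in> dominant_weights n. N (map_vec real_of_int l) < r}"
    using assms(2) by (simp add: dominant_weights_def)
  thus ?thesis unfolding count_below_def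
    using finite_weights_below[OF assms(1) subset_refl] by (auto simp: card_gt_0_iff)
qed

text \<open>Weights are classified by their shifted coordinates \<open>l $ i - i\<close>, since these are the points whose
Vandermonde product is the numerator of the degree.\<close>

definition weight_class :: "nat \<Rightarrow> nat \<Rightarrow> (nat \<Rightarrow> int) \<Rightarrow> int vec set" where
  "weight_class n M f = {l \<in> dominant_weights n. \<forall>i<n. (l $ i - int i) mod int M = f i}"

lemma weight_class_subset: "weight_class n M f \<subseteq> dominant_weights n"
  by (auto simp: weight_class_def)

text \<open>For every \<open>M\<close>, a vector with coordinates in \<open>{0..M * n}\<close> has norm at most \<open>shift_cost n N * M\<close>. The
linear dependence on \<open>M\<close> is what makes the scaling argument below work.\<close>

definition shift_cost :: "nat \<Rightarrow> (real vec \<Rightarrow> real) \<Rightarrow> real" where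
  "shift_cost n N = real n * (\<Sum>i<n. N (unit_vec n i))"

lemma shift_cost_nonneg: "is_norm n N \<Longrightarrow> shift_cost n N \<ge> 0"
  unfolding shift_cost_def by (intro mult_nonneg_nonneg sum_nonneg) (auto simp: is_norm_def)

text \<open>Adding one fixed dominant vector \<open>w\<close> that is congruent to \<open>g - f\<close> modulo \<open>M\<close> maps the class of
\<open>f\<close> injectively into the class of \<open>g\<close>. It keeps weights dominant, so there is no boundary
effect, and it raises the norm by a bounded amount.\<close>

lemma count_weight_class_le:
  assumes N: "is_norm n N" and M: "M > 0" and g: "\<And>i. i < n \<Longrightarrow> g i \<in> {0..<int M}"
  shows "count_below N (weight_class n M f) r \<le> count_below N (weight_class n M g) (r + shift_cost n N * M)"
proof -
  \<comment> \<open>The multiples of \<open>M\<close> decrease by \<open>M\<close> from one coordinate to the next, which outweighs any variation of the residues: \<open>w\<close> is dominant.\<close>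
  define w where "w = vec n (\<lambda>i. (g i - f i) mod int M + int M * (int n - 1 - int i))"
  have w: "w \<in> carrier_vec n" by (simp add: w_def)
  have w_nonneg: "w $ i \<ge> 0" if "i < n" for i
    using that M by (simp add: w_def)
  have w_le: "w $ i \<le> int M * int n" if "i < n" for i
  proof -
    have "(g i - f i) mod int M \<le> int M" using M by (simp add: less_imp_le)
    moreover have "int M * (int n - 1 - int i) \<le> int M * (int n - 1)"
      by (intro mult_left_mono) auto
    moreover have "w $ i = (g i - f i) mod int M + int M * (int n - 1 - int i)"
      using that by (simp add: w_def)
    moreover have "int M * (int n - 1) = int M * int n - int M" by (simp add: algebra_simps)
    ultimately show ?thesis by linarith
  qed
  have w_antimono: "w $ j \<le> w $ i" if "i \<le> j" "j < n" for i j
  proof (cases "i = j")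
    case False
    have "(g j - f j) mod int M \<le> int M" using M by (simp add: less_imp_le)
    moreover have "int M * (int n - 1 - int j + 1) \<le> int M * (int n - 1 - int i)"
      using that False by (intro mult_left_mono) auto
    moreover have "0 \<le> (g i - f i) mod int M" using M by simp
    ultimately show ?thesis using that by (simp add: w_def algebra_simps)
  qed simp
  have Nw: "N (map_vec real_of_int w) \<le> shift_cost n N * M"
  proof -
    have "N (map_vec real_of_int w) \<le> (\<Sum>i<n. \<bar>map_vec real_of_int w $ i\<bar> * N (unit_vec n i))"
      using w by (intro norm_le_weighted_l1[OF N]) simp
    also have "\<dots> \<le> (\<Sum>i<n. (real M * real n) * N (unit_vec n i))"
    proof (intro sum_mono mult_right_mono)
      fix i assume i: "i \<in> {..<n}"
      have "real_of_int (w $ i) \<le> real_of_int (int M * int n)"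
        using w_le i by (subst of_int_le_iff) auto
      thus "\<bar>map_vec real_of_int w $ i\<bar> \<le> real M * real n" using w w_nonneg i by simp
      show "0 \<le> N (unit_vec n i)" using N by (simp add: is_norm_def)
    qed
    finally show ?thesis by (simp add: shift_cost_def sum_distrib_left mult_ac)
  qed
  show ?thesis unfolding count_below_def
  proof (rule card_inj_on_le)
    show "inj_on (\<lambda>l. l + w) {l \<in> weight_class n M f. N (map_vec real_of_int l) < r}"
    proof (rule inj_onI)
      fix a b assume ab: "a \<in> {l \<in> weight_class n M f. N (map_vec real_of_int l) < r}"
        "b \<in> {l \<in> weight_class n M f. N (map_vec real_of_int l) < r}" "a + w = b + w"
      hence c: "a \<in> carrier_vec n" "b \<in> carrier_vec n"
        by (auto simp: weight_class_def dominant_weights_def)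
      show "a = b"
      proof (rule eq_vecI)
        fix i assume "i < dim_vec b"
        with ab(3) c w show "a $ i = b $ i"
          by (metis add_right_cancel carrier_vecD index_add_vec(1))
      qed (use c in auto)
    qed
    show "finite {l \<in> weight_class n M g. N (map_vec real_of_int l) < r + shift_cost n N * M}"
      by (rule finite_weights_below[OF N weight_class_subset])
    show "(\<lambda>l. l + w) ` {l \<in> weight_class n M f. N (map_vec real_of_int l) < r} \<subseteq>
      {l \<in> weight_class n M g. N (map_vec real_of_int l) < r + shift_cost n N * M}"
    proof safe
      fix l assume l: "l \<in> weight_class n M f" "N (map_vec real_of_int l) < r"
      have lc: "l \<in> carrier_vec n" and dom: "\<And>i j. i \<le> j \<Longrightarrow> j < n \<Longrightarrow> l $ i \<ge> l $ j"
        and nonneg: "\<And>i. i < n \<Longrightarrow> l $ i \<ge> 0"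
        and cls: "\<And>i. i < n \<Longrightarrow> (l $ i - int i) mod int M = f i"
        using l by (auto simp: weight_class_def dominant_weights_def)
      have "((l + w) $ i - int i) mod int M = g i" if i: "i < n" for i
      proof -
        have "(l + w) $ i - int i =
              ((l $ i - int i) + (g i - f i) mod int M) + int M * (int n - 1 - int i)"
          using i lc w by (simp add: w_def)
        hence "((l + w) $ i - int i) mod int M = ((l $ i - int i) mod int M + (g i - f i) mod int M) mod int M"
          by (simp only: mod_mult_self2 mod_add_left_eq)
        also have "\<dots> = (f i + (g i - f i) mod int M) mod int M" by (simp only: cls[OF i])
        also have "\<dots> = g i mod int M" by (simp add: mod_simps)
        finally show ?thesis using g[OF i] by simp
      qed
      moreover have "l + w \<in> dominant_weights n"
        using lc w dom nonneg w_antimono w_nonneg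
        by (auto simp: dominant_weights_def intro!: add_mono add_nonneg_nonneg)
      ultimately show "l + w \<in> weight_class n M g" by (simp add: weight_class_def)
      have "map_vec real_of_int (l + w) = map_vec real_of_int l + map_vec real_of_int w"
        using lc w by auto
      hence "N (map_vec real_of_int (l + w)) \<le> N (map_vec real_of_int l) + N (map_vec real_of_int w)"
        using is_norm_triangle[OF N] lc w by simp
      thus "N (map_vec real_of_int (l + w)) < r + shift_cost n N * M" using l(2) Nw by simp
    qed
  qed
qed

definition residue_vectors :: "nat \<Rightarrow> nat \<Rightarrow> (nat \<Rightarrow> int) set" where
  "residue_vectors n M = ({..<n} \<rightarrow>\<^sub>E {0..<int M})"

definition weight_residues :: "nat \<Rightarrow> nat \<Rightarrow> int vec \<Rightarrow> nat \<Rightarrow> int" where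
  "weight_residues n M l = restrict (\<lambda>i. (l $ i - int i) mod int M) {..<n}"

lemma finite_residue_vectors: "finite (residue_vectors n M)"
  unfolding residue_vectors_def by (intro finite_PiE) auto

lemma card_residue_vectors: "card (residue_vectors n M) = M ^ n"
  unfolding residue_vectors_def by (simp add: card_funcsetE)

lemma weight_class_eq:
  assumes "f \<in> residue_vectors n M"
  shows "weight_class n M f = {l \<in> dominant_weights n. weight_residues n M l = f}"
  using assms unfolding weight_class_def weight_residues_def residue_vectors_def
  by (auto simp: fun_eq_iff PiE_def extensional_def)

lemma count_below_residues:
  assumes N: "is_norm n N" and M: "M > 0" and T: "T \<subseteq> residue_vectors n M"
  shows "count_below N {l \<in> dominant_weights n. weight_residues n M l \<in> T} r =
         (\<Sum>f\<in>T. count_below N (weight_class n M f) r)"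
proof -
  define S where "S = {l \<in> {l \<in> dominant_weights n. weight_residues n M l \<in> T}. N (map_vec real_of_int l) < r}"
  have "(\<Sum>l\<in>S. 1::nat) = (\<Sum>f\<in>T. \<Sum>l\<in>{l \<in> S. weight_residues n M l = f}. 1)"
    unfolding S_def
    by (intro sum.group[symmetric] finite_weights_below[OF N] finite_subset[OF T finite_residue_vectors]) auto
  also have "\<dots> = (\<Sum>f\<in>T. count_below N (weight_class n M f) r)"
    unfolding count_below_def using T
    by (intro sum.cong refl) (auto simp: S_def weight_class_eq subset_iff intro!: arg_cong[of _ _ card])
  finally show ?thesis by (simp add: S_def count_below_def)
qed

lemma weight_residues_in: "M > 0 \<Longrightarrow> weight_residues n M l \<in> residue_vectors n M"
  by (auto simp: weight_residues_def residue_vectors_def)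

lemma count_dominant_eq_sum:
  assumes "is_norm n N" "M > 0"
  shows "count_below N (dominant_weights n) r = (\<Sum>f\<in>residue_vectors n M. count_below N (weight_class n M f) r)"
  using count_below_residues[OF assms subset_refl] assms(2) by (simp add: weight_residues_in)

text \<open>Both inequalities arise by summing the comparison of two classes over all \<open>M ^ n\<close> classes.\<close>

lemma count_class_sandwich:
  assumes N: "is_norm n N" and M: "M > 0" and g: "g \<in> residue_vectors n M"
  shows "M ^ n * count_below N (weight_class n M g) r \<le> count_below N (dominant_weights n) (r + shift_cost n N * M)"
    and "count_below N (dominant_weights n) r \<le> M ^ n * count_below N (weight_class n M g) (r + shift_cost n N * M)"
proof -
  have le: "count_below N (weight_class n M f) r \<le> count_below N (weight_class n M h) (r + shift_cost n N * M)"
    if "h \<in> residue_vectors n M" for f h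
    using that by (intro count_weight_class_le[OF N M]) (auto simp: residue_vectors_def PiE_iff)
  have "M ^ n * count_below N (weight_class n M g) r = (\<Sum>f\<in>residue_vectors n M. count_below N (weight_class n M g) r)"
    by (simp add: card_residue_vectors)
  also have "\<dots> \<le> (\<Sum>f\<in>residue_vectors n M. count_below N (weight_class n M f) (r + shift_cost n N * M))"
    by (intro sum_mono le)
  finally show "M ^ n * count_below N (weight_class n M g) r \<le> count_below N (dominant_weights n) (r + shift_cost n N * M)"
    by (simp add: count_dominant_eq_sum[OF N M])
  have "count_below N (dominant_weights n) r \<le> (\<Sum>f\<in>residue_vectors n M. count_below N (weight_class n M g) (r + shift_cost n N * M))"
    unfolding count_dominant_eq_sum[OF N M] by (intro sum_mono le g)
  thus "count_below N (dominant_weights n) r \<le> M ^ n * count_below N (weight_class n M g) (r + shift_cost n N * M)"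
    by (simp add: card_residue_vectors)
qed

text \<open>The class of the zero weight consists of the multiples of \<open>k\<close>, so it is a copy of the whole set of
dominant weights, scaled by \<open>k\<close>.\<close>

lemma count_multiples:
  assumes N: "is_norm n N" and k: "k > 0"
  shows "count_below N (weight_class n k (\<lambda>i\<in>{..<n}. (- int i) mod int k)) r =
         count_below N (dominant_weights n) (r / real k)"
proof -
  have norm_scale: "N (map_vec real_of_int (int k \<cdot>\<^sub>v l)) = real k * N (map_vec real_of_int l)"
    if "l \<in> carrier_vec n" for l
  proof -
    have "map_vec real_of_int (int k \<cdot>\<^sub>v l) = real k \<cdot>\<^sub>v map_vec real_of_int l"
      using that by auto
    thus ?thesis using N that by (simp add: is_norm_def)
  qed
  have "bij_betw (\<lambda>l. int k \<cdot>\<^sub>v l) {l \<in> dominant_weights n. N (map_vec real_of_int l) < r / real k}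
     {l \<in> weight_class n k (\<lambda>i\<in>{..<n}. (- int i) mod int k). N (map_vec real_of_int l) < r}"
  proof (rule bij_betw_byWitness[where f' = "map_vec (\<lambda>a. a div int k)"])
    show "\<forall>l\<in>{l \<in> dominant_weights n. N (map_vec real_of_int l) < r / real k}.
       map_vec (\<lambda>a. a div int k) (int k \<cdot>\<^sub>v l) = l"
      using k by (auto simp: vec_eq_iff)
    have div: "int k \<cdot>\<^sub>v map_vec (\<lambda>a. a div int k) l = l"
      and div_dom: "map_vec (\<lambda>a. a div int k) l \<in> dominant_weights n"
      if "l \<in> weight_class n k (\<lambda>i\<in>{..<n}. (- int i) mod int k)" for l
    proof -
      have lc: "l \<in> carrier_vec n" using that by (simp add: weight_class_def dominant_weights_def)
      have "int k dvd l $ i" if "i < n" for i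
        using \<open>l \<in> weight_class n k _\<close> that by (auto simp: weight_class_def mod_eq_dvd_iff)
      thus "int k \<cdot>\<^sub>v map_vec (\<lambda>a. a div int k) l = l" using lc by (auto simp: vec_eq_iff)
      show "map_vec (\<lambda>a. a div int k) l \<in> dominant_weights n"
        using that lc k by (auto simp: weight_class_def dominant_weights_def zdiv_mono1 pos_imp_zdiv_nonneg_iff)
    qed
    show "\<forall>l\<in>{l \<in> weight_class n k (\<lambda>i\<in>{..<n}. (- int i) mod int k). N (map_vec real_of_int l) < r}.
       int k \<cdot>\<^sub>v map_vec (\<lambda>a. a div int k) l = l"
      using div by blast
    show "(\<lambda>l. int k \<cdot>\<^sub>v l) ` {l \<in> dominant_weights n. N (map_vec real_of_int l) < r / real k} \<subseteq>
      {l \<in> weight_class n k (\<lambda>i\<in>{..<n}. (- int i) mod int k). N (map_vec real_of_int l) < r}"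
    proof safe
      fix l assume l: "l \<in> dominant_weights n" "N (map_vec real_of_int l) < r / real k"
      have lc: "l \<in> carrier_vec n" by (rule dominant_weights_carrier[OF l(1)])
      show "N (map_vec real_of_int (int k \<cdot>\<^sub>v l)) < r"
        using l(2) k by (simp add: norm_scale[OF lc] field_simps)
      show "int k \<cdot>\<^sub>v l \<in> weight_class n k (\<lambda>i\<in>{..<n}. (- int i) mod int k)"
        using l(1) lc by (auto simp: weight_class_def dominant_weights_def mod_eq_dvd_iff intro!: mult_left_mono)
    qed
    show "map_vec (\<lambda>a. a div int k) ` {l \<in> weight_class n k (\<lambda>i\<in>{..<n}. (- int i) mod int k). N (map_vec real_of_int l) < r}
      \<subseteq> {l \<in> dominant_weights n. N (map_vec real_of_int l) < r / real k}"
    proof safe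
      fix l assume l: "l \<in> weight_class n k (\<lambda>i\<in>{..<n}. (- int i) mod int k)" "N (map_vec real_of_int l) < r"
      show "map_vec (\<lambda>a. a div int k) l \<in> dominant_weights n" by (rule div_dom[OF l(1)])
      have "N (map_vec real_of_int l) = real k * N (map_vec real_of_int (map_vec (\<lambda>a. a div int k) l))"
        using norm_scale[OF dominant_weights_carrier[OF div_dom[OF l(1)]]] div[OF l(1)] by simp
      thus "N (map_vec real_of_int (map_vec (\<lambda>a. a div int k) l)) < r / real k"
        using l(2) k by (simp add: field_simps)
    qed
  qed
  thus ?thesis unfolding count_below_def by (rule bij_betw_same_card[symmetric])
qed

lemma count_dominant_scaling:
  assumes N: "is_norm n N" and k: "k > 0"
  shows "count_below N (dominant_weights n) r \<le> k ^ n * count_below N (dominant_weights n) (r / k + shift_cost n N)"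
    and "k ^ n * count_below N (dominant_weights n) (r / k - shift_cost n N) \<le> count_below N (dominant_weights n) r"
proof -
  have g: "(\<lambda>i\<in>{..<n}. (- int i) mod int k) \<in> residue_vectors n k"
    using k by (auto simp: residue_vectors_def)
  note sw = count_class_sandwich[OF N k g, unfolded count_multiples[OF N k]]
  show "count_below N (dominant_weights n) r \<le> k ^ n * count_below N (dominant_weights n) (r / k + shift_cost n N)"
    using sw(2)[of r] k by (simp add: add_divide_distrib)
  show "k ^ n * count_below N (dominant_weights n) (r / k - shift_cost n N) \<le> count_below N (dominant_weights n) r"
    using sw(1)[of "r - shift_cost n N * k"] k by (simp add: diff_divide_distrib)
qed

text \<open>The slow growth of the counting function comes from scaling alone. Comparing radius \<open>r + C\<close> with
\<open>(r + C) / (k + 1)\<close> and radius \<open>r\<close> with \<open>r / k\<close> by the scaling lemma, the second reduced radius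
eventually exceeds the first by more than the error terms, because \<open>r / k - r / (k + 1)\<close> grows
linearly in \<open>r\<close>. The price is the factor \<open>((k + 1) / k) ^ n\<close>, which is close to \<open>1\<close> for large
\<open>k\<close>.\<close>

lemma count_dominant_growth:
  assumes N: "is_norm n N" and k: "k > 0" and C: "C \<ge> 0"
    and r: "r \<ge> (2 * shift_cost n N + C) * (real k * real (Suc k))"
  shows "real (count_below N (dominant_weights n) (r + C)) \<le>
         (1 + 1 / real k) ^ n * real (count_below N (dominant_weights n) r)"
proof -
  define A where "A = (\<lambda>r. real (count_below N (dominant_weights n) r))"
  define c where "c = shift_cost n N"
  have sc1: "A r \<le> real j ^ n * A (r / j + c)" and sc2: "real j ^ n * A (r / j - c) \<le> A r" if "j > 0" for j r
    using count_dominant_scaling[OF N that, of r]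
    by (simp_all add: A_def c_def flip: of_nat_power of_nat_mult)
  have "(r + C) / Suc k + c \<le> r / k - c"
  proof -
    have "2 * c + C / Suc k \<le> 2 * c + C"
      using C mult_left_mono[of 1 "real (Suc k)" C] by (simp add: divide_le_eq)
    also have "\<dots> \<le> r / (real k * real (Suc k))"
      using r k by (simp add: pos_le_divide_eq c_def del: of_nat_Suc)
    also have "\<dots> = r / k - r / Suc k"
      using k by (simp add: field_simps)
    finally show ?thesis by (simp add: add_divide_distrib)
  qed
  hence mono: "A ((r + C) / Suc k + c) \<le> A (r / k - c)"
    unfolding A_def of_nat_le_iff by (intro count_below_mono[OF N]) auto
  have "A (r + C) \<le> real (Suc k) ^ n * A ((r + C) / Suc k + c)" by (intro sc1) simp
  also have "\<dots> \<le> real (Suc k) ^ n * A (r / k - c)" by (intro mult_left_mono mono) simp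
  also have "\<dots> = (1 + 1 / real k) ^ n * (real k ^ n * A (r / k - c))"
  proof -
    have "real (Suc k) = (1 + 1 / real k) * real k" using k by (simp add: field_simps)
    thus ?thesis by (simp only: power_mult_distrib mult.assoc)
  qed
  also have "\<dots> \<le> (1 + 1 / real k) ^ n * A r" using k by (intro mult_left_mono sc2) auto
  finally show ?thesis by (simp add: A_def)
qed

lemma count_dominant_shift_ratio:
  assumes N: "is_norm n N" and C: "C \<ge> 0"
  shows "((\<lambda>r. real (count_below N (dominant_weights n) (r + C)) / real (count_below N (dominant_weights n) r))
          \<longlongrightarrow> 1) at_top"
proof (rule order_tendstoI)
  fix a :: real assume "a < 1"
  have "1 \<le> real (count_below N (dominant_weights n) (r + C)) / real (count_below N (dominant_weights n) r)"
    if "r > 0" for r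
    using count_below_dominant_pos[OF N that] count_below_mono[OF N, of "dominant_weights n" "dominant_weights n" r "r + C"] C
    by (simp add: le_divide_eq)
  with \<open>a < 1\<close> show "\<forall>\<^sub>F r in at_top. a < real (count_below N (dominant_weights n) (r + C)) / real (count_below N (dominant_weights n) r)"
    by (intro eventually_mono[OF eventually_gt_at_top[of "0::real"]]) (meson less_le_trans)
next
  fix a :: real assume "a > 1"
  have "(\<lambda>k. (1 + 1 / real k) ^ n) \<longlonglongrightarrow> (1 + 0) ^ n"
    by (intro tendsto_power tendsto_add tendsto_const lim_1_over_n)
  hence "\<forall>\<^sub>F k in sequentially. (1 + 1 / real k) ^ n < a"
    using \<open>a > 1\<close> by (intro order_tendstoD) auto
  hence "\<forall>\<^sub>F k in sequentially. (1 + 1 / real k) ^ n < a \<and> k > 0"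
    using eventually_gt_at_top[of "0::nat"] by (rule eventually_conj)
  then obtain k where k: "(1 + 1 / real k) ^ n < a" "k > 0"
    using eventually_happens'[OF sequentially_bot] by blast
  define R where "R = (2 * shift_cost n N + C) * (real k * real (Suc k))"
  have "real (count_below N (dominant_weights n) (r + C)) / real (count_below N (dominant_weights n) r) < a"
    if "r \<ge> R" "r > 0" for r
  proof -
    have "real (count_below N (dominant_weights n) (r + C)) / real (count_below N (dominant_weights n) r) \<le> (1 + 1 / real k) ^ n"
      using count_dominant_growth[OF N k(2) C] that count_below_dominant_pos[OF N that(2)]
      by (simp add: divide_le_eq R_def)
    with k(1) show ?thesis by simp
  qed
  thus "\<forall>\<^sub>F r in at_top. real (count_below N (dominant_weights n) (r + C)) / real (count_below N (dominant_weights n) r) < a"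
    by (intro eventually_mono[OF eventually_conj[OF eventually_ge_at_top[of R] eventually_gt_at_top[of "0::real"]]]) auto
qed

definition weight_ratio :: "(real vec \<Rightarrow> real) \<Rightarrow> nat \<Rightarrow> int vec set \<Rightarrow> real \<Rightarrow> real" where
  "weight_ratio N n S r = real (count_below N S r) / real (count_below N (dominant_weights n) r)"

text \<open>Combine the sandwich between the counts at radii \<open>r - C\<close> and \<open>r + C\<close> with the fact that a bounded
change of the radius does not matter asymptotically.\<close>

lemma weight_ratio_class:
  assumes N: "is_norm n N" and M: "M > 0" and g: "g \<in> residue_vectors n M"
  shows "(weight_ratio N n (weight_class n M g) \<longlongrightarrow> 1 / real M ^ n) at_top"
proof -
  define A where "A = (\<lambda>r. real (count_below N (dominant_weights n) r))"
  define B where "B = (\<lambda>r. real (count_below N (weight_class n M g) r))"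
  define C where "C = shift_cost n N * M"
  have C: "C \<ge> 0" unfolding C_def using shift_cost_nonneg[OF N] by simp
  have up: "((\<lambda>r. A (r + C) / A r) \<longlongrightarrow> 1) at_top"
    unfolding A_def by (rule count_dominant_shift_ratio[OF N C])
  have "((\<lambda>r. A (r - C + C) / A (r - C)) \<longlongrightarrow> 1) at_top"
    using filterlim_compose[OF up, of "\<lambda>r. r - C" at_top] filterlim_tendsto_add_at_top[OF tendsto_const[of "- C"] filterlim_ident]
    by (simp add: add.commute)
  hence "((\<lambda>r. inverse (A r / A (r - C))) \<longlongrightarrow> inverse 1) at_top"
    by (intro tendsto_inverse) simp_all
  hence down: "((\<lambda>r. A (r - C) / A r) \<longlongrightarrow> 1) at_top" by simp
  have sw1: "real M ^ n * B r \<le> A (r + C)" and sw2: "A (r - C) \<le> real M ^ n * B r" for r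
    using count_class_sandwich(1)[OF N M g, of r] count_class_sandwich(2)[OF N M g, of "r - C"]
    by (simp_all add: A_def B_def C_def flip: of_nat_power of_nat_mult)
  have "((\<lambda>r. B r / A r) \<longlongrightarrow> 1 / real M ^ n) at_top"
  proof (rule tendsto_sandwich)
    show "((\<lambda>r. A (r - C) / A r / real M ^ n) \<longlongrightarrow> 1 / real M ^ n) at_top"
      using M by (intro tendsto_divide down tendsto_const) auto
    show "((\<lambda>r. A (r + C) / A r / real M ^ n) \<longlongrightarrow> 1 / real M ^ n) at_top"
      using M by (intro tendsto_divide up tendsto_const) auto
    have pos: "A r \<ge> 0" "real M ^ n > 0" for r using M by (auto simp: A_def)
    have swap: "a / A r / real M ^ n = a / real M ^ n / A r" for a r by simp
    show "\<forall>\<^sub>F r in at_top. A (r - C) / A r / real M ^ n \<le> B r / A r"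
      unfolding swap using sw2 pos
      by (intro always_eventually allI divide_right_mono) (simp_all add: pos_divide_le_eq mult.commute)
    show "\<forall>\<^sub>F r in at_top. B r / A r \<le> A (r + C) / A r / real M ^ n"
      unfolding swap using sw1 pos
      by (intro always_eventually allI divide_right_mono) (simp_all add: pos_le_divide_eq mult.commute)
  qed
  moreover have "weight_ratio N n (weight_class n M g) = (\<lambda>r. B r / A r)"
    by (simp add: fun_eq_iff weight_ratio_def A_def B_def)
  ultimately show ?thesis by simp
qed

lemma weight_ratio_residues:
  assumes N: "is_norm n N" and M: "M > 0" and T: "T \<subseteq> residue_vectors n M"
  shows "(weight_ratio N n {l \<in> dominant_weights n. weight_residues n M l \<in> T} \<longlongrightarrow> real (card T) / real M ^ n) at_top"
proof -
  have "((\<lambda>r. \<Sum>f\<in>T. weight_ratio N n (weight_class n M f) r) \<longlongrightarrow> (\<Sum>f\<in>T. 1 / real M ^ n)) at_top"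
    using T by (intro tendsto_sum weight_ratio_class[OF N M]) auto
  moreover have "weight_ratio N n {l \<in> dominant_weights n. weight_residues n M l \<in> T} =
      (\<lambda>r. \<Sum>f\<in>T. weight_ratio N n (weight_class n M f) r)"
    by (simp add: fun_eq_iff weight_ratio_def count_below_residues[OF N M T] sum_divide_distrib)
  ultimately show ?thesis by simp
qed

lemma weight_ratio_mono:
  assumes "is_norm n N" "S \<subseteq> T" "T \<subseteq> dominant_weights n"
  shows "weight_ratio N n S r \<le> weight_ratio N n T r"
  unfolding weight_ratio_def
  using count_below_mono[OF assms order_refl] by (intro divide_right_mono) auto

lemma weight_ratio_UN_le:
  assumes "finite I"
  shows "weight_ratio N n (\<Union>i\<in>I. S i) r \<le> (\<Sum>i\<in>I. weight_ratio N n (S i) r)"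
proof -
  have "{l \<in> (\<Union>i\<in>I. S i). N (map_vec real_of_int l) < r} = (\<Union>i\<in>I. {l \<in> S i. N (map_vec real_of_int l) < r})"
    by auto
  hence "count_below N (\<Union>i\<in>I. S i) r \<le> (\<Sum>i\<in>I. count_below N (S i) r)"
    unfolding count_below_def using card_UN_le[OF assms] by simp
  hence "real (count_below N (\<Union>i\<in>I. S i) r) \<le> (\<Sum>i\<in>I. real (count_below N (S i) r))"
    by (simp flip: of_nat_sum)
  thus ?thesis unfolding weight_ratio_def
    by (simp add: divide_right_mono flip: sum_divide_distrib)
qed

text \<open>A concrete norm is needed to pin down the density: a condition on all norms determines it only if
there is a norm.\<close>

lemma is_norm_l1: "is_norm n (\<lambda>x. \<Sum>i<n. \<bar>x $ i\<bar>)"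
  unfolding is_norm_def
proof (intro conjI ballI allI)
  fix x :: "real vec" assume x: "x \<in> carrier_vec n"
  show "0 \<le> (\<Sum>i<n. \<bar>x $ i\<bar>)" by (intro sum_nonneg) auto
  show "((\<Sum>i<n. \<bar>x $ i\<bar>) = 0) = (x = 0\<^sub>v n)"
    using x by (subst sum_nonneg_eq_0_iff) (auto simp: vec_eq_iff)
  show "(\<Sum>i<n. \<bar>(c \<cdot>\<^sub>v x) $ i\<bar>) = \<bar>c\<bar> * (\<Sum>i<n. \<bar>x $ i\<bar>)" for c
    using x by (simp add: sum_distrib_left abs_mult)
  fix y :: "real vec" assume y: "y \<in> carrier_vec n"
  have "(\<Sum>i<n. \<bar>(x + y) $ i\<bar>) \<le> (\<Sum>i<n. \<bar>x $ i\<bar> + \<bar>y $ i\<bar>)"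
    using x y by (intro sum_mono) auto
  thus "(\<Sum>i<n. \<bar>(x + y) $ i\<bar>) \<le> (\<Sum>i<n. \<bar>x $ i\<bar>) + (\<Sum>i<n. \<bar>y $ i\<bar>)"
    by (simp add: sum.distrib)
qed

section \<open>The degree as a quotient of Vandermonde products\<close>

lemma vandermonde_eq_gl_degree:
  "of_int (vandermonde n (\<lambda>i. l $ i - int i)) = gl_degree n l * of_int (superfact n)"
proof -
  have "gl_degree n l * of_int (superfact n) =
    (\<Prod>j<n. \<Prod>i<j. (of_int (l $ i - l $ j) + of_nat j - of_nat i) / (of_nat j - of_nat i) * of_int (- int i - - int j))"
    unfolding gl_degree_def vandermonde_def by (simp only: of_int_prod prod.distrib)
  also have "\<dots> = (\<Prod>j<n. \<Prod>i<j. of_int ((l $ i - int i) - (l $ j - int j)))"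
    by (intro prod.cong refl) (auto simp: field_simps)
  finally show ?thesis by (simp add: vandermonde_def)
qed

lemma gl_degree_multiple_iff:
  "(\<exists>k::int. gl_degree n l = of_int (int m * k)) \<longleftrightarrow>
   int m * superfact n dvd vandermonde n (\<lambda>i. l $ i - int i)"
proof -
  have sf: "superfact n \<noteq> 0" using superfact_pos[of n] by simp
  have "gl_degree n l = of_int (int m * k) \<longleftrightarrow>
        vandermonde n (\<lambda>i. l $ i - int i) = int m * superfact n * k" for k
  proof -
    have "gl_degree n l = of_int (int m * k) \<longleftrightarrow>
          gl_degree n l * of_int (superfact n) = of_int (int m * k) * of_int (superfact n)"
      using sf by simp
    also have "\<dots> \<longleftrightarrow> (of_int (vandermonde n (\<lambda>i. l $ i - int i)) :: rat) = of_int (int m * superfact n * k)"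
      by (simp add: vandermonde_eq_gl_degree mult_ac)
    finally show ?thesis by (simp only: of_int_eq_iff)
  qed
  thus ?thesis by (auto simp: dvd_def)
qed

lemma dominant_weights_not_dvd_eq:
  "dominant_weights_not_dvd m n =
   {l \<in> dominant_weights n. \<not> int m * superfact n dvd vandermonde n (\<lambda>i. l $ i - int i)}"
  unfolding dominant_weights_not_dvd_def gl_degree_multiple_iff ..

lemma vandermonde_dvd_mod_iff:
  "M dvd vandermonde n (\<lambda>i. x i mod M) \<longleftrightarrow> M dvd vandermonde n x"
proof -
  have "[vandermonde n (\<lambda>i. x i mod M) = vandermonde n x] (mod M)"
    unfolding vandermonde_def by (intro cong_prod cong_diff) (simp_all add: cong_def)
  thus ?thesis by (rule cong_dvd_iff)
qed

lemma vandermonde_cong: "(\<And>i. i < n \<Longrightarrow> x i = y i) \<Longrightarrow> vandermonde n x = vandermonde n y"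
  unfolding vandermonde_def by (intro prod.cong) auto

lemma not_dvd_ratio_eq: "not_dvd_ratio N m n = weight_ratio N n (dominant_weights_not_dvd m n)"
  by (simp add: fun_eq_iff not_dvd_ratio_def weight_ratio_def count_below_def)

text \<open>Divisibility of the degree by \<open>m\<close> is divisibility of the Vandermonde product by
\<open>M = m * superfact n\<close>, hence a condition on the residues modulo \<open>M\<close>, to which equidistribution
applies. The limit \<open>card T / M ^ n\<close> does not refer to the norm.\<close>

lemma not_dvd_ratio_limit_exists:
  assumes "m > 0"
  shows "\<exists>d. \<forall>N. is_norm n N \<longrightarrow> (not_dvd_ratio N m n \<longlongrightarrow> d) at_top"
proof -
  define M where "M = nat (int m * superfact n)"
  have M: "int M = int m * superfact n" and M0: "M > 0"
    using assms superfact_pos[of n] by (simp_all add: M_def)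
  define T where "T = {f \<in> residue_vectors n M. \<not> int M dvd vandermonde n f}"
  have "int M dvd vandermonde n (weight_residues n M l) \<longleftrightarrow> int M dvd vandermonde n (\<lambda>i. l $ i - int i)" for l
    by (subst vandermonde_dvd_mod_iff[symmetric], subst vandermonde_cong[of n "weight_residues n M l"])
       (auto simp: weight_residues_def)
  hence eq: "dominant_weights_not_dvd m n = {l \<in> dominant_weights n. weight_residues n M l \<in> T}"
    unfolding dominant_weights_not_dvd_eq T_def by (auto simp: weight_residues_in[OF M0] simp flip: M)
  show ?thesis
    unfolding not_dvd_ratio_eq eq
    by (intro exI allI impI, rule weight_ratio_residues[OF _ M0]) (auto simp: T_def)
qed

lemma not_dvd_ratio_tendsto_gl_density:
  assumes "m > 0" "is_norm n N"
  shows "(not_dvd_ratio N m n \<longlongrightarrow> gl_density m n) at_top"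
proof -
  obtain d where d: "\<And>N. is_norm n N \<Longrightarrow> (not_dvd_ratio N m n \<longlongrightarrow> d) at_top"
    using not_dvd_ratio_limit_exists[OF assms(1)] by blast
  have "gl_density m n = d"
    unfolding gl_density_def
  proof (rule the_equality)
    fix d' assume "\<forall>N. is_norm n N \<longrightarrow> (not_dvd_ratio N m n \<longlongrightarrow> d') at_top"
    hence "(not_dvd_ratio (\<lambda>x. \<Sum>i<n. \<bar>x $ i\<bar>) m n \<longlongrightarrow> d') at_top" using is_norm_l1 by blast
    thus "d' = d" using d[OF is_norm_l1] by (rule tendsto_unique[OF trivial_limit_at_top_linorder])
  qed (use d in blast)
  thus ?thesis using d assms(2) by simp
qed

section \<open>Bounds for the density\<close>

lemma card_inj_residue_vectors:
  "card {f \<in> {..<n} \<rightarrow>\<^sub>E B. inj_on f {..<n}} = (\<Prod>i<n. card B - i)" if "finite B"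
  using card_inj_on_subset_funcset[of "{..<n}" B "{..<n}"] that by (simp add: atLeast0LessThan)

lemma weight_residues_inj_iff:
  "inj_on (weight_residues n M l) {..<n} \<longleftrightarrow> inj_on (\<lambda>i. (l $ i - int i) mod int M) {..<n}"
  unfolding weight_residues_def by (intro inj_on_cong) auto

text \<open>A union bound over the primes dividing \<open>m\<close>: outside the divisible weights, the shifted coordinates
are pairwise incongruent modulo \<open>Q p\<close> for some \<open>p\<close>. The proportion of such residue vectors is the
birthday probability that \<open>n\<close> random residues modulo \<open>Q p\<close> are distinct.\<close>

lemma gl_density_le_sum:
  assumes "m > 0" and bound: "\<And>p. p \<in> prime_factors m \<Longrightarrow> \<exists>t. n \<le> p ^ Suc t \<and> Q p = p ^ (t + multiplicity p m)"
  shows "gl_density m n \<le> (\<Sum>p\<in>prime_factors m. (\<Prod>i<n. real (Q p - i) / real (Q p)))"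
proof -
  define N where "N = (\<lambda>x::real vec. \<Sum>i<n. \<bar>x $ i\<bar>)"
  have N: "is_norm n N" unfolding N_def by (rule is_norm_l1)
  define T where "T = (\<lambda>p. {f \<in> residue_vectors n (Q p). inj_on f {..<n}})"
  define S where "S = (\<lambda>p. {l \<in> dominant_weights n. weight_residues n (Q p) l \<in> T p})"
  have Q: "Q p > 0" if "p \<in> prime_factors m" for p
  proof -
    have "p > 0" using that by (auto intro: prime_gt_0_nat)
    thus ?thesis using bound[OF that] by auto
  qed
  have sub: "dominant_weights_not_dvd m n \<subseteq> (\<Union>p\<in>prime_factors m. S p)"
  proof
    fix l assume "l \<in> dominant_weights_not_dvd m n"
    hence l: "l \<in> dominant_weights n" and nd: "\<not> int m * superfact n dvd vandermonde n (\<lambda>i. l $ i - int i)"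
      by (simp_all add: dominant_weights_not_dvd_eq)
    obtain p where p: "p \<in> prime_factors m"
      and inj: "\<And>t. n \<le> p ^ Suc t \<Longrightarrow> inj_on (\<lambda>i. (l $ i - int i) mod int p ^ (t + multiplicity p m)) {..<n}"
      using not_dvd_vandermonde_imp_distinct[OF assms(1) nd] by blast
    obtain t where "n \<le> p ^ Suc t" "Q p = p ^ (t + multiplicity p m)" using bound[OF p] by blast
    with inj[of t] have "inj_on (\<lambda>i. (l $ i - int i) mod int (Q p)) {..<n}" by simp
    hence "l \<in> S p" using l Q[OF p] by (simp add: S_def T_def weight_residues_inj_iff weight_residues_in)
    with p show "l \<in> (\<Union>p\<in>prime_factors m. S p)" by blast
  qed
  have le: "not_dvd_ratio N m n r \<le> (\<Sum>p\<in>prime_factors m. weight_ratio N n (S p) r)" for r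
    unfolding not_dvd_ratio_eq
    by (rule order_trans[OF weight_ratio_mono[OF N sub] weight_ratio_UN_le]) (auto simp: S_def)
  have lim: "(weight_ratio N n (S p) \<longlongrightarrow> (\<Prod>i<n. real (Q p - i) / real (Q p))) at_top"
    if p: "p \<in> prime_factors m" for p
  proof -
    have "real (card (T p)) / real (Q p) ^ n = (\<Prod>i<n. real (Q p - i) / real (Q p))"
      unfolding T_def residue_vectors_def
      by (subst card_inj_residue_vectors) (simp_all add: prod_dividef)
    thus ?thesis
      using weight_ratio_residues[OF N Q[OF p], of "T p"] unfolding S_def by (auto simp: T_def)
  qed
  show ?thesis
  proof (rule tendsto_le[OF trivial_limit_at_top_linorder])
    show "((\<lambda>r. \<Sum>p\<in>prime_factors m. weight_ratio N n (S p) r) \<longlongrightarrow>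
           (\<Sum>p\<in>prime_factors m. (\<Prod>i<n. real (Q p - i) / real (Q p)))) at_top"
      by (intro tendsto_sum lim)
    show "(not_dvd_ratio N m n \<longlongrightarrow> gl_density m n) at_top"
      by (rule not_dvd_ratio_tendsto_gl_density[OF assms(1) N])
  qed (use le in auto)
qed

text \<open>The natural-number subtraction gives the factor \<open>0\<close> when \<open>i > Q\<close>; the factor for \<open>i = Q\<close> is \<open>0\<close> as
well, so the product is the birthday probability also for \<open>n > Q\<close>.\<close>

lemma prod_falling_le_exp:
  fixes Q n :: nat
  assumes "Q > 0"
  shows "(\<Prod>i<n. real (Q - i) / real Q) \<le> exp (- (real n * (real n - 1) / (2 * real Q)))"
proof -
  have gauss: "(\<Sum>i<n. real i) = real n * (real n - 1) / 2"
    by (induction n) (auto simp: field_simps)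
  have "(\<Prod>i<n. real (Q - i) / real Q) \<le> (\<Prod>i<n. exp (- (real i / real Q)))"
  proof (intro prod_mono conjI)
    fix i
    show "real (Q - i) / real Q \<le> exp (- (real i / real Q))"
    proof (cases "i \<le> Q")
      case True
      hence "real (Q - i) / real Q = 1 + (- (real i / real Q))"
        using assms by (simp add: of_nat_diff field_simps)
      thus ?thesis using exp_ge_add_one_self[of "- (real i / real Q)"] by simp
    qed simp
  qed simp
  also have "\<dots> = exp (- (real n * (real n - 1) / (2 * real Q)))"
    by (simp add: gauss sum_negf flip: exp_sum sum_divide_distrib)
  finally show ?thesis .
qed

text \<open>Choose \<open>t\<close> with \<open>p ^ t \<le> n \<le> p ^ (t + 1)\<close>. With \<open>k = multiplicity p m\<close> the modulus
\<open>Q = p ^ t * p ^ k\<close> is at most \<open>n * m\<close>, so the birthday exponent \<open>n * (n - 1) / (2 * Q)\<close> is at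
least \<open>(n - 1) / (2 * m)\<close>, and \<open>n - 1 \<ge> n / 2\<close>.\<close>

lemma gl_density_le:
  assumes m: "m > 0" and n: "n \<ge> 2"
  shows "gl_density m n \<le> real (omega m) * exp (- (real n / (4 * real m)))"
proof -
  have "\<exists>t. p ^ t \<le> n \<and> n \<le> p ^ Suc t" if "p \<in> prime_factors m" for p
  proof -
    have "p \<ge> 2" using that by (auto intro: prime_ge_2_nat)
    from ex_power_ivl1[OF this, of n] n show ?thesis by (auto intro: less_imp_le)
  qed
  then obtain t where t: "\<And>p. p \<in> prime_factors m \<Longrightarrow> p ^ t p \<le> n \<and> n \<le> p ^ Suc (t p)" by metis
  define Q where "Q = (\<lambda>p. p ^ (t p + multiplicity p m))"
  have "gl_density m n \<le> (\<Sum>p\<in>prime_factors m. (\<Prod>i<n. real (Q p - i) / real (Q p)))"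
    using t by (intro gl_density_le_sum[OF m]) (auto simp: Q_def)
  also have "\<dots> \<le> (\<Sum>p\<in>prime_factors m. exp (- (real n / (4 * real m))))"
  proof (intro sum_mono)
    fix p assume p: "p \<in> prime_factors m"
    have "p > 0" using p by (auto intro: prime_gt_0_nat)
    hence Q0: "Q p > 0" by (simp add: Q_def)
    have "p ^ multiplicity p m \<le> m"
      using m by (intro dvd_imp_le multiplicity_dvd)
    hence "Q p \<le> n * m" unfolding Q_def power_add using t[OF p] by (intro mult_le_mono) auto
    hence Qle: "real (Q p) \<le> real n * real m" by (metis of_nat_le_iff of_nat_mult)
    have "real n / (4 * real m) \<le> (real n - 1) / (2 * real m)"
      using m n by (simp add: field_simps)
    also have "\<dots> = real n * (real n - 1) / (2 * (real n * real m))"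
      using m n by (simp add: field_simps)
    also have "\<dots> \<le> real n * (real n - 1) / (2 * real (Q p))"
      using Qle Q0 m n by (intro divide_left_mono) auto
    finally have "exp (- (real n * (real n - 1) / (2 * real (Q p)))) \<le> exp (- (real n / (4 * real m)))"
      by simp
    with prod_falling_le_exp[OF Q0, of n]
    show "(\<Prod>i<n. real (Q p - i) / real (Q p)) \<le> exp (- (real n / (4 * real m)))" by linarith
  qed
  finally show ?thesis by (simp add: omega_def)
qed

lemma gl_density_le_one:
  assumes "m > 0"
  shows "gl_density m n \<le> 1"
proof (rule tendsto_upperbound[OF not_dvd_ratio_tendsto_gl_density[OF assms is_norm_l1]])
  show "\<forall>\<^sub>F r in at_top. not_dvd_ratio (\<lambda>x. \<Sum>i<n. \<bar>x $ i\<bar>) m n r \<le> 1"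
    unfolding not_dvd_ratio_eq weight_ratio_def
    using count_below_mono[OF is_norm_l1, of "dominant_weights_not_dvd m n" "dominant_weights n" n]
    by (intro always_eventually allI) (auto simp: dominant_weights_not_dvd_def divide_le_eq_1)
qed simp

text \<open>For a prime \<open>p\<close> dividing \<open>m\<close> and \<open>Q = p ^ (t + 1)\<close> with \<open>p ^ t \<le> n \<le> Q\<close>, the weights whose
shifted coordinates are modulo \<open>Q\<close> a permutation of those of the zero weight have degree prime to
\<open>p\<close>. They fill \<open>n!\<close> of the \<open>Q ^ n\<close> residue classes, and \<open>Q \<le> p * n \<le> m * n\<close>.\<close>

lemma gl_density_ge:
  assumes m: "m \<ge> 2" and n: "n \<ge> 1"
  shows "fact n / (real m * real n) ^ n \<le> gl_density m n"
proof -
  obtain p where p: "prime p" and pm: "p dvd m" using prime_factor_nat[of m] m by auto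
  have p0: "p > 0" using prime_gt_0_nat[OF p] .
  obtain t where t: "p ^ t \<le> n" "n \<le> p ^ Suc t"
    using ex_power_ivl1[OF prime_ge_2_nat[OF p] n] by (auto intro: less_imp_le)
  define Q where "Q = p ^ Suc t"
  have Q0: "Q > 0" using p0 by (simp add: Q_def)
  have "p \<le> m" using pm m by (intro dvd_imp_le) auto
  hence "Q \<le> m * n" unfolding Q_def power_Suc using t by (intro mult_le_mono) auto
  hence Qle: "real Q \<le> real m * real n" by (metis of_nat_le_iff of_nat_mult)
  define B where "B = (\<lambda>i. (- int i) mod int Q) ` {..<n}"
  define T where "T = {f \<in> {..<n} \<rightarrow>\<^sub>E B. inj_on f {..<n}}"
  define S where "S = {l \<in> dominant_weights n. weight_residues n Q l \<in> T}"
  define N where "N = (\<lambda>x::real vec. \<Sum>i<n. \<bar>x $ i\<bar>)"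
  have N: "is_norm n N" unfolding N_def by (rule is_norm_l1)
  have "inj_on (\<lambda>i. (- int i) mod int Q) {..<n}"
    using not_dvd_initial[OF _ _ t(2)] by (intro linorder_inj_onI') (auto simp: mod_eq_dvd_iff Q_def)
  hence cardB: "card B = n" unfolding B_def by (simp add: card_image)
  have cardT: "card T = fact n"
    unfolding T_def by (subst card_inj_residue_vectors)
      (simp_all add: cardB, simp_all add: B_def fact_prod_rev atLeast0LessThan)
  have T: "T \<subseteq> residue_vectors n Q"
  proof -
    have "B \<subseteq> {0..<int Q}" using Q0 by (auto simp: B_def)
    thus ?thesis unfolding T_def residue_vectors_def using PiE_mono by blast
  qed
  have sub: "S \<subseteq> dominant_weights_not_dvd m n"
  proof
    fix l assume "l \<in> S"
    hence l: "l \<in> dominant_weights n" and res: "weight_residues n Q l \<in> T" by (auto simp: S_def)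
    define x where "x = (\<lambda>i. l $ i - int i)"
    have inj: "inj_on (\<lambda>i. x i mod int p ^ Suc t) {..<n}"
      using res unfolding T_def x_def by (simp add: weight_residues_inj_iff Q_def)
    have "(\<lambda>i. x i mod int p ^ Suc t) ` {..<n} \<subseteq> B"
      using res by (auto simp: T_def weight_residues_def PiE_iff x_def Q_def)
    hence "(\<lambda>i. x i mod int p ^ Suc t) ` {..<n} = B"
      using inj by (intro card_subset_eq) (simp_all add: card_image cardB, simp add: B_def)
    hence "\<not> int p * superfact n dvd vandermonde n x"
      using inj by (intro not_dvd_vandermonde_if_initial_residues[OF p t(2)]) (auto simp: B_def Q_def)
    hence "\<not> int m * superfact n dvd vandermonde n x"
      using pm by (meson dvd_trans mult_dvd_mono dvd_refl of_nat_dvd_iff)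
    thus "l \<in> dominant_weights_not_dvd m n" using l by (simp add: dominant_weights_not_dvd_eq x_def)
  qed
  have "fact n / (real m * real n) ^ n \<le> fact n / real Q ^ n"
    using Qle Q0 m n by (intro divide_left_mono power_mono mult_pos_pos zero_less_power) auto
  also have "\<dots> \<le> gl_density m n"
  proof (rule tendsto_le[OF trivial_limit_at_top_linorder])
    show "(not_dvd_ratio N m n \<longlongrightarrow> gl_density m n) at_top"
      using m by (intro not_dvd_ratio_tendsto_gl_density[OF _ N]) simp
    show "(weight_ratio N n S \<longlongrightarrow> fact n / real Q ^ n) at_top"
      using weight_ratio_residues[OF N Q0 T] unfolding S_def by (simp add: cardT)
    show "\<forall>\<^sub>F r in at_top. weight_ratio N n S r \<le> not_dvd_ratio N m n r"
      unfolding not_dvd_ratio_eq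
      by (intro always_eventually allI weight_ratio_mono[OF N sub]) (auto simp: dominant_weights_not_dvd_def)
  qed
  finally show ?thesis .
qed

theorem theorem1p1:
  fixes m n :: nat
  assumes "m \<ge> 1" and "n \<ge> 1"
  shows "(\<forall>N. is_norm n N \<longrightarrow> (not_dvd_ratio N m n \<longlongrightarrow> gl_density m n) at_top) \<and>
    (m \<noteq> 1 \<longrightarrow> fact n / (real m * real n) ^ n \<le> gl_density m n) \<and>
    (n \<noteq> 1 \<or> omega m \<noteq> 1 \<longrightarrow>
       gl_density m n \<le> real (omega m) * exp (- (real n / (4 * real m))))"
proof (intro conjI allI impI)
  fix N assume "is_norm n N"
  thus "(not_dvd_ratio N m n \<longlongrightarrow> gl_density m n) at_top"
    using assms by (intro not_dvd_ratio_tendsto_gl_density) auto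
next
  assume "m \<noteq> 1"
  thus "fact n / (real m * real n) ^ n \<le> gl_density m n" using assms by (intro gl_density_ge) auto
next
  assume cases: "n \<noteq> 1 \<or> omega m \<noteq> 1"
  show "gl_density m n \<le> real (omega m) * exp (- (real n / (4 * real m)))"
  proof (cases "n \<ge> 2")
    case True
    thus ?thesis using assms by (intro gl_density_le) auto
  next
    case False
    hence n: "n = 1" using assms by simp
    with cases consider "omega m = 0" | "omega m \<ge> 2" by linarith
    thus ?thesis
    proof cases
      case 1
      \<comment> \<open>Here \<open>m = 1\<close>, and the union bound over the empty set of primes gives density \<open>0\<close>.\<close>
      hence "prime_factors m = {}" by (simp add: omega_def)
      thus ?thesis using gl_density_le_sum[of m n "\<lambda>_. 0"] assms 1 by simp
    next
      case 2
      \<comment> \<open>With at least two prime factors the right-hand side is at least \<open>2 * exp (-1/4)\<close>, which exceeds \<open>1\<close>.\<close>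
      have "1 / (4 * real m) \<le> 1 / 2" using assms by (simp add: field_simps)
      hence "1 / 2 \<le> 1 + - (1 / (4 * real m))" by simp
      also have "\<dots> \<le> exp (- (1 / (4 * real m)))" by (rule exp_ge_add_one_self)
      finally have "2 * (1 / 2) \<le> real (omega m) * exp (- (1 / (4 * real m)))"
        using 2 by (intro mult_mono) auto
      thus ?thesis using gl_density_le_one[of m n] assms n by simp
    qed
  qed
qed

end
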